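(* Let $\tau>0$, let $\mathcal T_2=[0,1]\times[0,1]$, let $\varepsilon_1,\varepsilon_2\in C([0,1])$ with $\varepsilon_1(y)>0$, $\varepsilon_2(y)>0$ for all $y\in[0,1]$, let $q_1,h_1,h_2\in C([0,1])$, and let $g_i, C_{ij}\in C(\mathcal T_2)$ for $i,j=1,2$. Consider the system for $(F_1,F_2)$ on $\mathcal T_2$ $$\frac1\tau\partial_xF_1(x,y)-\varepsilon_1(y)\partial_yF_1(x,y)=g_1(x,y)+\sum_{k=1}^2C_{1k}(x,y)F_k(x,y),$$ $$\frac1\tau\partial_xF_2(x,y)+\varepsilon_2(y)\partial_yF_2(x,y)=g_2(x,y)+\sum_{k=1}^2C_{2k}(x,y)F_k(x,y),$$ with boundary conditions $$F_1(x,1)=0,\qquad F_1(0,y)=h_1(y),\qquad F_2(x,0)=q_1(x)F_1(x,0),\qquad F_2(0,y)=h_2(y).$$ Then there exists a unique solution $(F_1,F_2)$ of this boundary value problem with $F_k\in C(\mathcal T_2)$, $k=1,2$.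
   Context: Solutions are understood in the sense of the method of characteristics: along every characteristic curve $s\mapsto(X(s),Y(s))$ of the first equation ($X'=1/\tau$, $Y'=-\varepsilon_1(Y)$) contained in $\mathcal T_2$, the function $F_1(X(s),Y(s))$ is the integral of the right-hand side of the first equation, and along every characteristic curve of the second equation ($X'=1/\tau$, $Y'=\varepsilon_2(Y)$) contained in $\mathcal T_2$, the function $F_2(X(s),Y(s))$ is the integral of the right-hand side of the second equation. The boundary values are those prescribed on the sides of $\mathcal T_2$ where the respective characteristics enter: $\{y=1\}$ and $\{x=0\}$ for $F_1$, and $\{y=0\}$ and $\{x=0\}$ for $F_2$.
   Formalization: The corner compatibility conditions h_1(1)=0 and h_2(0)=q_1(0)h_1(0) are added as hypotheses; every solution forces them, and without them (e.g. h_1 constantly 1) no solution exists. *)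

theory Defs
  imports "HOL-Analysis.Analysis"
begin

definition T2 :: "(real \<times> real) set" where
  "T2 = {0..1} \<times> {0..1}"

text \<open>Characteristic curves on a compact parameter interval, contained in \<^term>\<open>T2\<close>.
  Derivatives at the two end points are one-sided.\<close>

definition characteristic ::
  "real \<Rightarrow> (real \<Rightarrow> real) \<Rightarrow> real \<Rightarrow> real \<Rightarrow> (real \<Rightarrow> real) \<Rightarrow> (real \<Rightarrow> real) \<Rightarrow> bool" where
  "characteristic \<tau> v a b X Y \<longleftrightarrow>
     a \<le> b \<and>
     (\<forall>s\<in>{a..b}. (X s, Y s) \<in> T2
        \<and> (X has_real_derivative 1 / \<tau>) (at s within {a..b})
        \<and> (Y has_real_derivative v (Y s)) (at s within {a..b}))"

text \<open>\<open>f\<close> solves \<open>(1/\<tau>) \<partial>\<^sub>x f + v(y) \<partial>\<^sub>y f = r\<close> on \<^term>\<open>T2\<close> in the sense of characteristics.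
  The increment is prescribed over every segment of every characteristic, so \<open>f\<close> along the
  curve is the indefinite integral of \<open>r\<close>.\<close>

definition solves_transport ::
  "real \<Rightarrow> (real \<Rightarrow> real) \<Rightarrow> (real \<times> real \<Rightarrow> real) \<Rightarrow> (real \<times> real \<Rightarrow> real) \<Rightarrow> bool" where
  "solves_transport \<tau> v r f \<longleftrightarrow>
     (\<forall>a b X Y. characteristic \<tau> v a b X Y \<longrightarrow>
        ((\<lambda>s. r (X s, Y s)) has_integral (f (X b, Y b) - f (X a, Y a))) {a..b})"

text \<open>Families indexed by \<open>{1,2}\<close> are functions of a natural number; their values at other
  indices are irrelevant.\<close>

definition solves_bvp ::
  "real \<Rightarrow> (nat \<Rightarrow> real \<Rightarrow> real) \<Rightarrow> (nat \<Rightarrow> real \<times> real \<Rightarrow> real)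
     \<Rightarrow> (nat \<Rightarrow> nat \<Rightarrow> real \<times> real \<Rightarrow> real) \<Rightarrow> (real \<Rightarrow> real) \<Rightarrow> (nat \<Rightarrow> real \<Rightarrow> real)
     \<Rightarrow> (nat \<Rightarrow> real \<times> real \<Rightarrow> real) \<Rightarrow> bool" where
  "solves_bvp \<tau> \<epsilon> g C q1 h F \<longleftrightarrow>
     solves_transport \<tau> (\<lambda>y. - \<epsilon> 1 y) (\<lambda>p. g 1 p + (\<Sum>k=1..2. C 1 k p * F k p)) (F 1) \<and>
     solves_transport \<tau> (\<epsilon> 2) (\<lambda>p. g 2 p + (\<Sum>k=1..2. C 2 k p * F k p)) (F 2) \<and>
     (\<forall>x\<in>{0..1}. F 1 (x, 1) = 0) \<and>
     (\<forall>y\<in>{0..1}. F 1 (0, y) = h 1 y) \<and>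
     (\<forall>x\<in>{0..1}. F 2 (x, 0) = q1 x * F 1 (x, 0)) \<and>
     (\<forall>y\<in>{0..1}. F 2 (0, y) = h 2 y)"

text \<open>Two boundary conditions meet at the corner \<open>(0,1)\<close> for \<open>F 1\<close> and at \<open>(0,0)\<close> for \<open>F 2\<close>.
  Solvability therefore forces the data to match there, and the existence theorem has to
  assume it.\<close>

lemma solves_bvp_corner_compatibility:
  assumes "solves_bvp \<tau> \<epsilon> g C q1 h F"
  shows "h 1 1 = 0" and "h 2 0 = q1 0 * h 1 0"
proof -
  have *: "\<forall>x\<in>{0..1}. F 1 (x, 1) = 0" "\<forall>y\<in>{0..1}. F 1 (0, y) = h 1 y"
    "\<forall>x\<in>{0..1}. F 2 (x, 0) = q1 x * F 1 (x, 0)" "\<forall>y\<in>{0..1}. F 2 (0, y) = h 2 y"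
    using assms unfolding solves_bvp_def by blast+
  show "h 1 1 = 0"
    using bspec[OF *(1), of 0] bspec[OF *(2), of 1] by simp
  show "h 2 0 = q1 0 * h 1 0"
    using bspec[OF *(2), of 0] bspec[OF *(3), of 0] bspec[OF *(4), of 0] by simp
qed

end

theory Submission
  imports Defs
begin

text \<open>The travel time \<open>\<Phi>(y) = \<integral>\<^sub>0\<^sup>y d\<eta> / v(\<eta>)\<close> turns the characteristics of a single transport
  equation into lines of slope 1, so that the equation with prescribed right-hand side and inflow
  data is solved by an explicit integral; the corner conditions make the solution continuous.
  Feeding the previous iterate into the right-hand sides, and the new \<open>F 1\<close> into the
  boundary value of \<open>F 2\<close>, gives a Picard map. Since \<open>x\<close> grows at speed \<open>1/\<tau>\<close> along every
  characteristic, this map is a contraction in the supremum norm with weight \<open>exp (-l x)\<close>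
  once \<open>l\<close> is large.\<close>

section \<open>Travel time along one characteristic family and its inverse\<close>

text \<open>Since \<open>v\<close> is only continuous, the characteristic ODE is solved by
  separation of variables: \<open>\<Phi>\<close> is strictly increasing because its derivative
  \<open>1 / v\<close> is positive, and its inverse \<open>\<Psi>\<close> then satisfies
  \<open>\<Psi>' = v (\<Psi>)\<close>. All derivatives are taken within closed intervals, so that
  curves starting or ending on the sides of the square are covered.\<close>

lemma travel_time:
  fixes v :: "real \<Rightarrow> real"
  assumes v: "continuous_on {0..1} v" and pos: "\<And>y. y \<in> {0..1} \<Longrightarrow> v y > 0"
  obtains \<Phi> \<Psi> :: "real \<Rightarrow> real" and L where
    "\<Phi> 0 = 0" "L > 0"
    "\<And>y. y \<in> {0..1} \<Longrightarrow> \<Phi> y \<in> {0..L}" "\<And>t. t \<in> {0..L} \<Longrightarrow> \<Psi> t \<in> {0..1}"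
    "\<And>y. y \<in> {0..1} \<Longrightarrow> \<Psi> (\<Phi> y) = y" "\<And>t. t \<in> {0..L} \<Longrightarrow> \<Phi> (\<Psi> t) = t"
    "continuous_on {0..1} \<Phi>" "continuous_on {0..L} \<Psi>"
    "\<And>y. y \<in> {0..1} \<Longrightarrow> (\<Phi> has_real_derivative 1 / v y) (at y within {0..1})"
    "\<And>t. t \<in> {0..L} \<Longrightarrow> (\<Psi> has_real_derivative v (\<Psi> t)) (at t within {0..L})"
proof -
  define \<Phi> where "\<Phi> y = integral {0..y} (\<lambda>\<eta>. 1 / v \<eta>)" for y
  define L where "L = \<Phi> 1"
  define \<Psi> where "\<Psi> = the_inv_into {0..1} \<Phi>"
  have nz: "v y \<noteq> 0" if "y \<in> {0..1}" for y using pos[OF that] by simp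
  have d\<Phi>: "(\<Phi> has_real_derivative 1 / v y) (at y within {0..1})" if "y \<in> {0..1}" for y
    unfolding \<Phi>_def using that nz
    by (intro integral_has_real_derivative continuous_intros v) auto
  have c\<Phi>: "continuous_on {0..1} \<Phi>"
    using d\<Phi> by (meson DERIV_continuous_on)
  have mono: "\<Phi> x < \<Phi> y" if "x \<in> {0..1}" "y \<in> {0..1}" "x < y" for x y
  proof (rule DERIV_pos_imp_increasing_open[OF \<open>x < y\<close>])
    fix z assume "x < z" "z < y"
    then have z: "0 < z" "z < 1" using that by auto
    then show "\<exists>d. DERIV \<Phi> z :> d \<and> d > 0"
      using d\<Phi>[of z] pos[of z] by (auto simp: at_within_Icc_at intro!: exI[of _ "1 / v z"])
  next
    show "continuous_on {x..y} \<Phi>" using c\<Phi> by (rule continuous_on_subset) (use that in auto)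
  qed
  have inj: "inj_on \<Phi> {0..1}" 
    by (rule inj_onI) (metis mono linorder_less_linear order_less_irrefl)
  have \<Phi>0: "\<Phi> 0 = 0" by (simp add: \<Phi>_def)
  have L: "L > 0" using mono[of 0 1] \<Phi>0 by (simp add: L_def)
  have mono': "\<Phi> x \<le> \<Phi> y" if "x \<in> {0..1}" "y \<in> {0..1}" "x \<le> y" for x y
    using mono[of x y] that by (cases "x = y") auto
  have img: "\<Phi> ` {0..1} = {0..L}"
  proof (intro equalityI subsetI)
    fix t assume "t \<in> \<Phi> ` {0..1}"
    then show "t \<in> {0..L}" using mono'[of 0] mono'[of _ 1] by (auto simp: L_def \<Phi>0)
  next
    fix t assume "t \<in> {0..L}"
    then show "t \<in> \<Phi> ` {0..1}" using IVT'[of \<Phi> 0 t 1] c\<Phi> by (auto simp: L_def \<Phi>0)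
  qed
  have \<Psi>\<Phi>: "\<Psi> (\<Phi> y) = y" if "y \<in> {0..1}" for y
    unfolding \<Psi>_def using the_inv_into_f_f[OF inj that] .
  have \<Phi>\<Psi>: "\<Phi> (\<Psi> t) = t" if "t \<in> {0..L}" for t
    unfolding \<Psi>_def using f_the_inv_into_f[OF inj, of t] that img by auto
  have \<Psi>in: "\<Psi> t \<in> {0..1}" if "t \<in> {0..L}" for t
    unfolding \<Psi>_def using the_inv_into_into[OF inj, of t "{0..1}"] that img by auto
  have c\<Psi>: "continuous_on {0..L} \<Psi>"
    using continuous_on_inv[OF c\<Phi>, of \<Psi>] \<Psi>\<Phi> img by auto
  have d\<Psi>: "(\<Psi> has_real_derivative v (\<Psi> t)) (at t within {0..L})" if t: "t \<in> {0..L}" for t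
  proof -
    \<comment> \<open>Inverse function rule, one-sided at the end points: insert
      \<open>y = \<Psi> s\<close> into the difference quotient of \<open>\<Phi>\<close>, then take
      reciprocals. Injectivity of \<open>\<Psi>\<close> on \<open>{0..L}\<close> keeps
      \<open>\<Psi> s\<close> away from \<open>\<Psi> t\<close>.\<close>
    have "((\<lambda>y. (\<Phi> y - \<Phi> (\<Psi> t)) / (y - \<Psi> t)) \<longlongrightarrow> 1 / v (\<Psi> t)) (at (\<Psi> t) within {0..1})"
      using d\<Phi>[OF \<Psi>in[OF t]] by (simp add: has_field_derivative_iff)
    moreover have "filterlim \<Psi> (at (\<Psi> t) within {0..1}) (at t within {0..L})"
    proof -
      have "(\<Psi> \<longlongrightarrow> \<Psi> t) (at t within {0..L})"
        using c\<Psi> t by (simp add: continuous_on)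
      moreover have "\<forall>\<^sub>F s in at t within {0..L}. \<Psi> s \<in> {0..1} - {\<Psi> t}"
        unfolding eventually_at_topological
        by (rule exI[of _ UNIV]) (metis DiffI \<Phi>\<Psi> \<Psi>in iso_tuple_UNIV_I open_UNIV singletonD t)
      ultimately show ?thesis by (auto simp: filterlim_at elim: eventually_mono)
    qed
    ultimately have "((\<lambda>s. (\<Phi> (\<Psi> s) - \<Phi> (\<Psi> t)) / (\<Psi> s - \<Psi> t)) \<longlongrightarrow> 1 / v (\<Psi> t)) (at t within {0..L})"
      by (rule filterlim_compose)
    then have "((\<lambda>s. inverse ((\<Phi> (\<Psi> s) - \<Phi> (\<Psi> t)) / (\<Psi> s - \<Psi> t))) \<longlongrightarrow> inverse (1 / v (\<Psi> t))) (at t within {0..L})"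
      by (rule tendsto_inverse) (use nz[OF \<Psi>in[OF t]] in simp)
    moreover have "\<forall>\<^sub>F s in at t within {0..L}.
        inverse ((\<Phi> (\<Psi> s) - \<Phi> (\<Psi> t)) / (\<Psi> s - \<Psi> t)) = (\<Psi> s - \<Psi> t) / (s - t)"
      unfolding eventually_at_topological by (rule exI[of _ UNIV]) (use \<Phi>\<Psi> t in auto)
    ultimately have "((\<lambda>s. (\<Psi> s - \<Psi> t) / (s - t)) \<longlongrightarrow> inverse (1 / v (\<Psi> t))) (at t within {0..L})"
      by (rule Lim_transform_eventually)
    then show ?thesis by (simp add: has_field_derivative_iff)
  qed
  show thesis
    using that[of \<Phi> L \<Psi>] \<Phi>0 L img \<Psi>in \<Psi>\<Phi> \<Phi>\<Psi> c\<Phi> c\<Psi> d\<Phi> d\<Psi> by blast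
qed

section \<open>Characteristics as lines of slope 1\<close>

lemma unit_slope:
  fixes f :: "real \<Rightarrow> real"
  assumes "\<And>s. s \<in> {a..b} \<Longrightarrow> (f has_real_derivative 1) (at s within {a..b})" and "s \<in> {a..b}"
  shows "f s = f a + (s - a)"
proof -
  have "\<exists>c. \<forall>x\<in>{a..b}. f x - x = c"
    by (rule has_field_derivative_zero_constant) (auto intro!: derivative_eq_intros assms(1))
  then obtain c where "\<forall>x\<in>{a..b}. f x - x = c" by blast
  then have "f s - s = c" "f a - a = c" using assms(2) by auto
  then show ?thesis by simp
qed

lemma characteristic_fst:
  assumes ch: "characteristic \<tau> v a b X Y" and "\<tau> > 0" and s: "s \<in> {a..b}"
  shows "\<tau> * X s = \<tau> * X a + (s - a)"
proof (rule unit_slope[OF _ s])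
  fix s assume "s \<in> {a..b}"
  then have "(X has_real_derivative 1 / \<tau>) (at s within {a..b})"
    using ch by (simp add: characteristic_def)
  then show "((\<lambda>s. \<tau> * X s) has_real_derivative 1) (at s within {a..b})"
    using \<open>\<tau> > 0\<close> by (auto intro!: derivative_eq_intros)
qed

text \<open>By the chain rule \<open>\<Phi> (Y s)\<close> has derivative
  \<open>(1 / v (Y s)) * v (Y s) = 1\<close>. Together with \<open>characteristic_fst\<close> and
  the injectivity of \<open>\<Phi>\<close>, this determines every characteristic by its initial
  point.\<close>

lemma characteristic_snd:
  assumes ch: "characteristic \<tau> v a b X Y"
    and pos: "\<And>y. y \<in> {0..1} \<Longrightarrow> v y > 0"
    and d\<Phi>: "\<And>y. y \<in> {0..1} \<Longrightarrow> (\<Phi> has_real_derivative 1 / v y) (at y within {0..1})"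
    and s: "s \<in> {a..b}"
  shows "\<Phi> (Y s) = \<Phi> (Y a) + (s - a)"
proof (rule unit_slope[OF _ s])
  fix s assume s: "s \<in> {a..b}"
  have in01: "\<And>s. s \<in> {a..b} \<Longrightarrow> Y s \<in> {0..1}"
    and dY: "(Y has_real_derivative v (Y s)) (at s within {a..b})"
    using ch s by (auto simp: characteristic_def T2_def)
  have "(\<Phi> has_real_derivative 1 / v (Y s)) (at (Y s) within Y ` {a..b})"
    by (rule has_field_derivative_subset[OF d\<Phi>[OF in01[OF s]]]) (use in01 in auto)
  from DERIV_image_chain[OF this dY]
  show "((\<lambda>s. \<Phi> (Y s)) has_real_derivative 1) (at s within {a..b})"
    using pos[OF in01[OF s]] by (simp add: o_def)
qed

text \<open>Follow the line of slope 1 backwards from \<open>(\<tau> * x, \<Phi> y)\<close> until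
  the first of its two coordinates vanishes.\<close>

lemma characteristic_to_inflow:
  assumes v: "continuous_on {0..1} v" and pos: "\<And>y. y \<in> {0..1} \<Longrightarrow> v y > 0"
    and \<tau>: "\<tau> > 0" and xy: "(x, y) \<in> T2"
  obtains b X Y where "characteristic \<tau> v 0 b X Y" "X b = x" "Y b = y" "X 0 = 0 \<or> Y 0 = 0"
proof -
  obtain \<Phi> \<Psi> L where tt: "\<Phi> 0 = 0" "L > 0"
    "\<And>y. y \<in> {0..1} \<Longrightarrow> \<Phi> y \<in> {0..L}" "\<And>t. t \<in> {0..L} \<Longrightarrow> \<Psi> t \<in> {0..1}"
    "\<And>y. y \<in> {0..1} \<Longrightarrow> \<Psi> (\<Phi> y) = y"
    "\<And>t. t \<in> {0..L} \<Longrightarrow> (\<Psi> has_real_derivative v (\<Psi> t)) (at t within {0..L})"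
    using travel_time[OF v pos] by metis
  \<comment> \<open>The point is \<open>\<tau> * x\<close> time units away from the side
    \<open>x = 0\<close> and \<open>\<Phi> y\<close> units away from \<open>y = 0\<close>; the
    smaller number is the time since entry.\<close>
  define b where "b = min (\<tau> * x) (\<Phi> y)"
  define X where "X s = x + (s - b) / \<tau>" for s
  define Y where "Y s = \<Psi> (\<Phi> y + (s - b))" for s
  have x: "0 \<le> x" "x \<le> 1" and y: "y \<in> {0..1}" using xy by (auto simp: T2_def)
  have b: "0 \<le> b" "b \<le> \<tau> * x" "b \<le> \<Phi> y" using x tt(3)[OF y] \<tau> by (auto simp: b_def)
  have rng: "\<Phi> y + (s - b) \<in> {0..L}" if "s \<in> {0..b}" for s
    using that b tt(3)[OF y] by auto
  have "characteristic \<tau> v 0 b X Y"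
    unfolding characteristic_def
  proof (intro conjI ballI)
    fix s assume s: "s \<in> {0..b}"
    have "(s - b) / \<tau> \<le> 0" using s \<tau> by (simp add: divide_nonpos_pos)
    moreover have "x + (s - b) / \<tau> \<ge> 0" using s b \<tau> by (simp add: field_simps)
    ultimately show "(X s, Y s) \<in> T2"
      using tt(4)[OF rng[OF s]] x by (auto simp: T2_def X_def Y_def)
    show "(X has_real_derivative 1 / \<tau>) (at s within {0..b})"
      unfolding X_def using \<tau> by (auto intro!: derivative_eq_intros)
    have "(\<Psi> has_real_derivative v (Y s)) (at (\<Phi> y + (s - b)) within (\<lambda>s. \<Phi> y + (s - b)) ` {0..b})"
      unfolding Y_def by (rule has_field_derivative_subset[OF tt(6)[OF rng[OF s]]]) (use rng in auto)
    moreover have "((\<lambda>s. \<Phi> y + (s - b)) has_real_derivative 1) (at s within {0..b})"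
      by (auto intro!: derivative_eq_intros)
    ultimately show "(Y has_real_derivative v (Y s)) (at s within {0..b})"
      using DERIV_image_chain[of \<Psi> "v (Y s)" "\<lambda>s. \<Phi> y + (s - b)" s "{0..b}" 1]
      by (simp add: o_def Y_def[abs_def])
  qed (rule b)
  moreover have "X 0 = 0 \<or> Y 0 = 0"
  proof (cases "\<tau> * x \<le> \<Phi> y")
    case True then show ?thesis using \<tau> by (simp add: X_def b_def)
  next
    case False then show ?thesis using tt(5)[of 0] tt(1) by (simp add: Y_def b_def)
  qed
  ultimately show thesis using that[of b X Y] tt(5)[OF y] by (simp add: X_def Y_def)
qed

section \<open>Exponentially weighted bound for one transport equation\<close>

text \<open>Integrate the bound on \<open>r\<close> along the characteristic from its entry point.
  As \<open>X' = 1 / \<tau>\<close>, integrating \<open>exp (l * X s)\<close> gains the factor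
  \<open>\<tau> / l\<close>, which is the source of the contraction. The inflow term keeps its
  constant because \<open>X\<close> increases, so the weight at entry is at most the weight at
  \<open>x\<close>.\<close>

lemma transport_bound:
  assumes v: "continuous_on {0..1} v" and pos: "\<And>y. y \<in> {0..1} \<Longrightarrow> v y > 0"
    and \<tau>: "\<tau> > 0" and l: "l > 0"
    and f: "solves_transport \<tau> v r f"
    and r: "\<And>x y. (x, y) \<in> T2 \<Longrightarrow> \<bar>r (x, y)\<bar> \<le> R * exp (l * x)"
    and in0: "\<And>y. y \<in> {0..1} \<Longrightarrow> f (0, y) = 0"
    and inflow: "\<And>x. x \<in> {0..1} \<Longrightarrow> \<bar>f (x, 0)\<bar> \<le> A * exp (l * x)"
    and xy: "(x, y) \<in> T2"
  shows "\<bar>f (x, y)\<bar> \<le> (A + R * \<tau> / l) * exp (l * x)"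
proof -
  obtain b X Y where ch: "characteristic \<tau> v 0 b X Y" and fin: "X b = x" "Y b = y"
    and start: "X 0 = 0 \<or> Y 0 = 0"
    using characteristic_to_inflow[OF v pos \<tau> xy] by metis
  have b: "0 \<le> b" and T: "\<And>s. s \<in> {0..b} \<Longrightarrow> (X s, Y s) \<in> T2"
    and dX: "\<And>s. s \<in> {0..b} \<Longrightarrow> (X has_real_derivative 1 / \<tau>) (at s within {0..b})"
    using ch unfolding characteristic_def by auto
  have X: "\<tau> * x = \<tau> * X 0 + b"
    using characteristic_fst[OF ch \<tau>, of b] b fin by simp
  have X0: "X 0 \<le> x"
  proof -
    have "\<tau> * X 0 \<le> \<tau> * x" using X b by simp
    then show ?thesis using \<tau> by simp
  qed
  have R: "0 \<le> R"
    using order_trans[OF abs_ge_zero r[OF xy]] by (simp add: zero_le_mult_iff)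
  have A: "0 \<le> A"
    using order_trans[OF abs_ge_zero inflow[of 0]] by (simp add: zero_le_mult_iff)
  have st: "\<bar>f (X 0, Y 0)\<bar> \<le> A * exp (l * x)"
  proof (cases "X 0 = 0")
    case True
    then show ?thesis using in0[of "Y 0"] T[of 0] b A by (simp add: T2_def)
  next
    case False
    then have "\<bar>f (X 0, Y 0)\<bar> \<le> A * exp (l * X 0)"
      using start inflow[of "X 0"] T[of 0] b by (simp add: T2_def)
    also have "\<dots> \<le> A * exp (l * x)" using X0 A l by (intro mult_left_mono) auto
    finally show ?thesis .
  qed
  have int: "((\<lambda>s. r (X s, Y s)) has_integral (f (X b, Y b) - f (X 0, Y 0))) {0..b}"
    using f ch unfolding solves_transport_def by blast
  have E: "((\<lambda>s. R * exp (l * X s)) has_integral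
      (R * \<tau> / l * exp (l * X b) - R * \<tau> / l * exp (l * X 0))) {0..b}"
    by (rule fundamental_theorem_of_calculus[OF b])
      (use \<tau> l in \<open>auto intro!: derivative_eq_intros dX simp: has_real_derivative_iff_has_vector_derivative[symmetric]\<close>)
  have "\<bar>f (X b, Y b) - f (X 0, Y 0)\<bar> \<le> R * \<tau> / l * exp (l * X b) - R * \<tau> / l * exp (l * X 0)"
    using has_integral_norm_bound_integral_component[OF int E, of 1] r T by auto
  \<comment> \<open>The contribution of the entry point is nonpositive and is dropped.\<close>
  also have "\<dots> \<le> R * \<tau> / l * exp (l * x)" using R \<tau> l fin by simp
  finally show ?thesis using st fin by (simp add: algebra_simps)
qed

section \<open>Existence for one transport equation\<close>

text \<open>The substitution \<open>t = m z * \<theta>\<close> moves the dependence on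
  \<open>z\<close> from the limit of integration into the integrand, where continuity of parameter
  integrals over a fixed interval applies.\<close>

lemma continuous_on_diagonal_integral:
  fixes R :: "real \<times> real \<Rightarrow> real"
  assumes R: "continuous_on UNIV R"
    and p: "continuous_on S p" and q: "continuous_on S q" and m: "continuous_on S m"
    and m0: "\<And>z. z \<in> S \<Longrightarrow> m z \<ge> 0"
  shows "continuous_on S (\<lambda>z. integral {0..m z} (\<lambda>t. R (p z + t, q z + t)))"
proof -
  have cR: "continuous_on U g \<Longrightarrow> continuous_on U (\<lambda>z. R (g z))" for U and g :: "'b::topological_space \<Rightarrow> _"
    by (rule continuous_on_compose2[OF R]) auto
  have "integral {0..m z} (\<lambda>t. R (p z + t, q z + t))
      = m z * integral {0..1} (\<lambda>\<theta>. R (p z + m z * \<theta>, q z + m z * \<theta>))" if "z \<in> S" for z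
  proof -
    \<comment> \<open>The substitution is obtained by differentiating
      \<open>?J (m z * \<theta>)\<close> in \<open>\<theta>\<close>; this also covers the degenerate
      case \<open>m z = 0\<close>.\<close>
    let ?J = "\<lambda>s. integral {0..s} (\<lambda>t. R (p z + t, q z + t))"
    have "((\<lambda>\<theta>. m z * R (p z + m z * \<theta>, q z + m z * \<theta>)) has_integral (?J (m z * 1) - ?J (m z * 0))) {0..1}"
    proof (rule fundamental_theorem_of_calculus)
      fix \<theta> :: real assume \<theta>: "\<theta> \<in> {0..1}"
      have im: "(\<lambda>\<theta>. m z * \<theta>) ` {0..1} \<subseteq> {0..m z}"
        using m0[OF that] by (auto intro: mult_left_le)
      have "(?J has_real_derivative R (p z + m z * \<theta>, q z + m z * \<theta>)) (at (m z * \<theta>) within {0..m z})"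
        by (rule integral_has_real_derivative) (use im \<theta> in \<open>force intro!: cR continuous_intros\<close>)+
      then have "(?J has_real_derivative R (p z + m z * \<theta>, q z + m z * \<theta>)) 
          (at (m z * \<theta>) within (\<lambda>\<theta>. m z * \<theta>) ` {0..1})"
        using im by (rule has_field_derivative_subset)
      moreover have "((\<lambda>\<theta>. m z * \<theta>) has_real_derivative m z) (at \<theta> within {0..1})"
        by (auto intro!: derivative_eq_intros)
      ultimately have "(?J \<circ> (\<lambda>\<theta>. m z * \<theta>) has_real_derivative
          R (p z + m z * \<theta>, q z + m z * \<theta>) * m z) (at \<theta> within {0..1})"
        by (rule DERIV_image_chain)
      then show "((\<lambda>\<theta>. ?J (m z * \<theta>)) has_vector_derivative m z * R (p z + m z * \<theta>, q z + m z * \<theta>)) (at \<theta> within {0..1})"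
        by (simp add: o_def has_real_derivative_iff_has_vector_derivative mult.commute)
    qed simp
    then have "integral {0..1} (\<lambda>\<theta>. m z * R (p z + m z * \<theta>, q z + m z * \<theta>)) = ?J (m z)"
      by (auto dest: integral_unique)
    then show ?thesis by simp
  qed
  moreover have "continuous_on S (\<lambda>z. m z * integral (cbox 0 1) (\<lambda>\<theta>. R (p z + m z * \<theta>, q z + m z * \<theta>)))"
    by (intro continuous_intros m integral_continuous_on_param)
      (auto simp: split_beta intro!: cR continuous_intros continuous_on_compose2[OF p]
        continuous_on_compose2[OF q] continuous_on_compose2[OF m])
  ultimately show ?thesis by (simp cong: continuous_on_cong)
qed

text \<open>In the coordinates \<open>(\<tau> x, \<Phi> y)\<close> the characteristics are the lines of slope 1, and the point
  \<open>(u, w)\<close> is reached at time \<open>min u w\<close> from its entry point \<open>(max 0 (u - w), max 0 (w - u))\<close>.\<close>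

lemma transport_exists:
  assumes v: "continuous_on {0..1} v" and pos: "\<And>y. y \<in> {0..1} \<Longrightarrow> v y > 0"
    and \<tau>: "\<tau> > 0" and r: "continuous_on T2 r"
    and b0: "continuous_on {0..1} b0" and h0: "continuous_on {0..1} h0" and corner: "b0 0 = h0 0"
  obtains f where "continuous_on T2 f" "solves_transport \<tau> v r f"
    "\<And>x. x \<in> {0..1} \<Longrightarrow> f (x, 0) = b0 x" "\<And>y. y \<in> {0..1} \<Longrightarrow> f (0, y) = h0 y"
proof -
  obtain \<Phi> \<Psi> :: "real \<Rightarrow> real" and L where
    \<Phi>0: "\<Phi> 0 = 0" and L: "L > 0" and
    \<Phi>L: "\<And>y. y \<in> {0..1} \<Longrightarrow> \<Phi> y \<in> {0..L}" and \<Psi>1: "\<And>t. t \<in> {0..L} \<Longrightarrow> \<Psi> t \<in> {0..1}" and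
    \<Psi>\<Phi>: "\<And>y. y \<in> {0..1} \<Longrightarrow> \<Psi> (\<Phi> y) = y" and
    c\<Phi>: "continuous_on {0..1} \<Phi>" and c\<Psi>: "continuous_on {0..L} \<Psi>" and
    d\<Phi>: "\<And>y. y \<in> {0..1} \<Longrightarrow> (\<Phi> has_real_derivative 1 / v y) (at y within {0..1})"
    using travel_time[OF v pos] by metis
  have \<Psi>0: "\<Psi> 0 = 0" using \<Psi>\<Phi>[of 0] \<Phi>0 by simp
  \<comment> \<open>The right-hand side in the coordinates \<open>u = \<tau> x\<close>,
    \<open>w = \<Phi> y\<close>; clamping both arguments extends it continuously to the whole
    plane.\<close>
  define R where "R = (\<lambda>(u, w). r (max 0 (min 1 (u / \<tau>)), \<Psi> (max 0 (min L w))))"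
  have cR: "continuous_on UNIV R"
  proof -
    have "max 0 (min L w) \<in> {0..L}" for w :: real using L by auto
    moreover from this have "(max 0 (min 1 (u / \<tau>)), \<Psi> (max 0 (min L w))) \<in> T2" for u w
      using \<Psi>1[of "max 0 (min L w)"] by (simp add: T2_def)
    ultimately show ?thesis
      unfolding R_def split_beta using \<tau>
      by (intro continuous_on_compose2[OF r] continuous_on_Pair continuous_on_compose2[OF c\<Psi>]
          continuous_on_max continuous_on_min continuous_on_divide continuous_on_const
          continuous_on_fst continuous_on_snd continuous_on_id) (simp_all add: image_subset_iff)
  qed
  have Rr: "R (\<tau> * x, \<Phi> y) = r (x, y)" if "(x, y) \<in> T2" for x y
    using that \<Phi>L[of y] \<Psi>\<Phi>[of y] \<tau> by (simp add: R_def T2_def)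
  define p where "p z = max 0 (\<tau> * fst z - \<Phi> (snd z))" for z
  define q where "q z = max 0 (\<Phi> (snd z) - \<tau> * fst z)" for z
  define m where "m z = min (\<tau> * fst z) (\<Phi> (snd z))" for z
  \<comment> \<open>At least one of \<open>p z\<close> and \<open>q z\<close> is zero, so one of the
    two boundary terms equals the common corner value and cancels against \<open>h0 0\<close>. This
    single formula gives the right inflow value on both sides and is visibly continuous across the
    characteristic through the corner.\<close>
  define f where "f z = b0 (p z / \<tau>) + h0 (\<Psi> (q z)) - h0 0 
      + integral {0..m z} (\<lambda>t. R (p z + t, q z + t))" for z
  have c\<Phi>': "continuous_on T2 (\<lambda>z. \<Phi> (snd z))"
    by (rule continuous_on_compose2[OF c\<Phi>]) (auto simp: T2_def intro!: continuous_intros)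
  have cp: "continuous_on T2 p" and cq: "continuous_on T2 q" and cm: "continuous_on T2 m"
    unfolding p_def q_def m_def by (intro continuous_intros c\<Phi>')+
  have m0: "m z \<ge> 0" if "z \<in> T2" for z
    using that \<Phi>L[of "snd z"] \<tau> by (auto simp: m_def T2_def)
  have qL: "q z \<in> {0..L}" if "z \<in> T2" for z
  proof -
    have "\<tau> * fst z \<ge> 0" using that \<tau> by (auto simp: T2_def)
    then show ?thesis using that \<Phi>L[of "snd z"] L by (auto simp: q_def T2_def)
  qed
  have p1: "p z / \<tau> \<in> {0..1}" if "z \<in> T2" for z
  proof -
    have "\<tau> * fst z \<le> \<tau>" "0 \<le> \<Phi> (snd z)" using that \<tau> \<Phi>L[of "snd z"] by (auto simp: T2_def)
    then have "\<tau> * fst z - \<Phi> (snd z) \<le> \<tau>" by linarith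
    then have "p z \<le> \<tau>" using \<tau> by (simp add: p_def)
    then show ?thesis using \<tau> by (auto simp: p_def)
  qed
  have "continuous_on T2 f"
    unfolding f_def using \<tau>
    by (intro continuous_on_add continuous_on_diff continuous_on_const
        continuous_on_diagonal_integral[OF cR cp cq cm m0]
        continuous_on_compose2[OF b0] continuous_on_compose2[OF h0] continuous_on_compose2[OF c\<Psi>]
        continuous_on_divide cp cq)
      (use p1 qL \<Psi>1 in \<open>auto simp: image_subset_iff\<close>)
  moreover have "solves_transport \<tau> v r f"
    unfolding solves_transport_def
  proof (intro allI impI)
    fix a b X Y assume ch: "characteristic \<tau> v a b X Y"
    then have ab: "a \<le> b" and T: "\<And>s. s \<in> {a..b} \<Longrightarrow> (X s, Y s) \<in> T2"
      by (auto simp: characteristic_def)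
    define P Q M where "P = p (X a, Y a)" and "Q = q (X a, Y a)" and "M = m (X a, Y a)"
    \<comment> \<open>Both coordinates grow at unit speed, so their difference, and hence the entry
      point, is constant along the curve; only the time since entry advances. The increment of
      \<open>f\<close> is therefore an increment of \<open>?J\<close>.\<close>
    have PQM: "p (X s, Y s) = P" "q (X s, Y s) = Q" "m (X s, Y s) = M + (s - a)"
      "P + (M + (s - a)) = \<tau> * X s" "Q + (M + (s - a)) = \<Phi> (Y s)" if "s \<in> {a..b}" for s
      using characteristic_fst[OF ch \<tau> that] characteristic_snd[OF ch pos d\<Phi> that]
      by (auto simp: p_def q_def m_def P_def Q_def M_def)
    let ?J = "\<lambda>s. integral {0..s} (\<lambda>t. R (P + t, Q + t))"
    have M0: "M \<ge> 0" unfolding M_def using m0 T ab by simp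
    have "((\<lambda>s. r (X s, Y s)) has_integral (?J (M + (b - a)) - ?J (M + (a - a)))) {a..b}"
    proof (rule fundamental_theorem_of_calculus[OF ab])
      fix s assume s: "s \<in> {a..b}"
      have im: "(\<lambda>s. M + (s - a)) ` {a..b} \<subseteq> {0..M + (b - a)}"
        using M0 by auto
      have "(?J has_real_derivative R (P + (M + (s - a)), Q + (M + (s - a))))
          (at (M + (s - a)) within {0..M + (b - a)})"
        by (rule integral_has_real_derivative)
          (use im s in \<open>force intro!: continuous_on_compose2[OF cR] continuous_intros\<close>)+
      then have "(?J has_real_derivative r (X s, Y s)) (at (M + (s - a)) within (\<lambda>s. M + (s - a)) ` {a..b})"
        unfolding PQM(4,5)[OF s] Rr[OF T[OF s]] using im by (rule has_field_derivative_subset)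
      moreover have "((\<lambda>s. M + (s - a)) has_real_derivative 1) (at s within {a..b})"
        by (auto intro!: derivative_eq_intros)
      ultimately have "(?J \<circ> (\<lambda>s. M + (s - a)) has_real_derivative r (X s, Y s) * 1) (at s within {a..b})"
        by (rule DERIV_image_chain)
      then show "((\<lambda>s. ?J (M + (s - a))) has_vector_derivative r (X s, Y s)) (at s within {a..b})"
        by (simp add: o_def has_real_derivative_iff_has_vector_derivative)
    qed
    moreover have "f (X s, Y s) = b0 (P / \<tau>) + h0 (\<Psi> Q) - h0 0 + ?J (M + (s - a))" if "s \<in> {a..b}" for s
      by (simp add: f_def PQM[OF that])
    ultimately show "((\<lambda>s. r (X s, Y s)) has_integral f (X b, Y b) - f (X a, Y a)) {a..b}"
      using ab by simp
  qed
  moreover have "f (x, 0) = b0 x" if "x \<in> {0..1}" for x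
    using that \<tau> by (simp add: f_def p_def q_def m_def \<Phi>0 \<Psi>0)
  moreover have "f (0, y) = h0 y" if "y \<in> {0..1}" for y
    using that \<Phi>L[OF that] \<Psi>\<Phi>[OF that] corner by (simp add: f_def p_def q_def m_def)
  ultimately show thesis by (rule that)
qed

section \<open>Fixed points and uniqueness in a weighted supremum norm\<close>

text \<open>Writing \<open>u = w * \<phi>\<close> turns the weighted norm of \<open>u\<close> into
  the ordinary supremum norm of \<open>\<phi>\<close>, and Banach's theorem applies in the complete
  space of bounded continuous functions. \<open>step\<close> is a relation because an equation on
  the box leaves values outside it undetermined; for the same reason \<open>z\<close> and
  \<open>u\<close> are matched only on the box.\<close>

lemma weighted_contraction_fixpoint:
  fixes w :: "'a::euclidean_space \<Rightarrow> real"
    and step :: "('a \<Rightarrow> 'b::banach) \<Rightarrow> ('a \<Rightarrow> 'b) \<Rightarrow> bool"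
  assumes ne: "\<And>i. i \<in> Basis \<Longrightarrow> a \<bullet> i \<le> b \<bullet> i"
    and w: "continuous_on (cbox a b) w" and wpos: "\<And>p. p \<in> cbox a b \<Longrightarrow> w p > 0"
    and \<kappa>: "0 \<le> \<kappa>" "\<kappa> < 1"
    and ex: "\<And>u. continuous_on (cbox a b) u \<Longrightarrow> \<exists>z. continuous_on (cbox a b) z \<and> step u z"
    and contr: "\<And>u u' z z' M p. \<lbrakk>step u z; step u' z';
        \<And>p. p \<in> cbox a b \<Longrightarrow> norm (u p - u' p) \<le> M * w p; p \<in> cbox a b\<rbrakk>
      \<Longrightarrow> norm (z p - z' p) \<le> \<kappa> * M * w p"
  obtains u z where "continuous_on (cbox a b) u" "step u z" "\<And>p. p \<in> cbox a b \<Longrightarrow> z p = u p"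
proof -
  \<comment> \<open>The next \<open>\<phi>\<close> is \<open>z / w\<close> on the box;
    \<open>clamp\<close> extends it to a bounded continuous function on the whole space without
    enlarging distances. Choice then yields the operator \<open>A\<close> on the
    \<open>\<phi>\<close> and the underlying results \<open>Z\<close>.\<close>
  have "\<exists>\<psi> :: 'a \<Rightarrow>\<^sub>C 'b. \<exists>z. step (\<lambda>p. w p *\<^sub>R \<phi> p) z \<and>
      (\<forall>p. \<psi> p = z (clamp a b p) /\<^sub>R w (clamp a b p))" for \<phi> :: "'a \<Rightarrow>\<^sub>C 'b"
  proof -
    have "continuous_on (cbox a b) (\<lambda>p. w p *\<^sub>R \<phi> p)" by (intro continuous_intros w) simp
    then obtain z where z: "continuous_on (cbox a b) z" "step (\<lambda>p. w p *\<^sub>R \<phi> p) z"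
      using ex by meson
    have "continuous_on (cbox a b) (\<lambda>p. z p /\<^sub>R w p)"
      by (intro continuous_intros w z(1)) (use wpos in force)
    then obtain \<psi> :: "'a \<Rightarrow>\<^sub>C 'b" where "\<And>p. \<psi> p = z (clamp a b p) /\<^sub>R w (clamp a b p)"
      by (rule continuous_on_cbox_bcontfunE) (rule that)
    then show ?thesis using z(2) by (intro exI conjI allI)
  qed
  then have "\<forall>\<phi> :: 'a \<Rightarrow>\<^sub>C 'b. \<exists>\<psi> :: 'a \<Rightarrow>\<^sub>C 'b. \<exists>z. step (\<lambda>p. w p *\<^sub>R \<phi> p) z \<and>
      (\<forall>p. \<psi> p = z (clamp a b p) /\<^sub>R w (clamp a b p))" ..
  from choice[OF this] obtain A :: "('a \<Rightarrow>\<^sub>C 'b) \<Rightarrow> ('a \<Rightarrow>\<^sub>C 'b)" where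
    "\<forall>\<phi> :: 'a \<Rightarrow>\<^sub>C 'b. \<exists>z. step (\<lambda>p. w p *\<^sub>R apply_bcontfun \<phi> p) z \<and>
      (\<forall>p. apply_bcontfun (A \<phi>) p = z (clamp a b p) /\<^sub>R w (clamp a b p))" ..
  from choice[OF this] obtain Z :: "('a \<Rightarrow>\<^sub>C 'b) \<Rightarrow> ('a \<Rightarrow> 'b)" where
    ZA: "\<forall>\<phi> :: 'a \<Rightarrow>\<^sub>C 'b. step (\<lambda>p. w p *\<^sub>R apply_bcontfun \<phi> p) (Z \<phi>) \<and>
      (\<forall>p. apply_bcontfun (A \<phi>) p = Z \<phi> (clamp a b p) /\<^sub>R w (clamp a b p))" ..
  note Z = ZA[THEN spec, THEN conjunct1] and A = ZA[THEN spec, THEN conjunct2, THEN spec]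
  have "\<forall>\<phi> \<psi>. dist (A \<phi>) (A \<psi>) \<le> \<kappa> * dist \<phi> \<psi>"
  proof (intro allI dist_bound)
    fix \<phi> \<psi> :: "'a \<Rightarrow>\<^sub>C 'b" and p
    let ?c = "clamp a b p"
    have c: "?c \<in> cbox a b" using ne by (rule clamp_in_interval)
    have "norm (Z \<phi> ?c - Z \<psi> ?c) \<le> \<kappa> * dist \<phi> \<psi> * w ?c"
    \<comment> \<open>Here \<open>M\<close> is the supremum distance of \<open>\<phi>\<close> and
      \<open>\<psi>\<close>.\<close>
    proof (rule contr[OF Z Z _ c])
      fix p assume p: "p \<in> cbox a b"
      have "norm (w p *\<^sub>R \<phi> p - w p *\<^sub>R \<psi> p) = dist (\<phi> p) (\<psi> p) * w p"
        using wpos[OF p] by (simp add: dist_norm flip: scaleR_diff_right)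
      also have "\<dots> \<le> dist \<phi> \<psi> * w p"
        by (intro mult_right_mono dist_bounded) (use wpos[OF p] in simp)
      finally show "norm (w p *\<^sub>R \<phi> p - w p *\<^sub>R \<psi> p) \<le> dist \<phi> \<psi> * w p" .
    qed
    then have "norm (Z \<phi> ?c - Z \<psi> ?c) / w ?c \<le> \<kappa> * dist \<phi> \<psi>"
      using wpos[OF c] by (simp only: pos_divide_le_eq)
    moreover have "dist (A \<phi> p) (A \<psi> p) = norm (Z \<phi> ?c - Z \<psi> ?c) / w ?c"
      unfolding A dist_norm scaleR_diff_right[symmetric] norm_scaleR
      using wpos[OF c] by (simp add: divide_inverse)
    ultimately show "dist (A \<phi> p) (A \<psi> p) \<le> \<kappa> * dist \<phi> \<psi>" by simp
  qed
  from banach_fix_type[OF \<kappa> this] obtain \<phi> where \<phi>: "A \<phi> = \<phi>" by blast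
  have "continuous_on (cbox a b) (\<lambda>p. w p *\<^sub>R \<phi> p)" by (intro continuous_intros w) simp
  moreover have "Z \<phi> p = w p *\<^sub>R \<phi> p" if "p \<in> cbox a b" for p
  proof -
    have "\<phi> p = Z \<phi> p /\<^sub>R w p"
      using A[of \<phi> p] unfolding \<phi> clamp_cancel_cbox[OF that] .
    then have "w p *\<^sub>R \<phi> p = w p *\<^sub>R (Z \<phi> p /\<^sub>R w p)" by (rule arg_cong)
    then show ?thesis using wpos[OF that] by simp
  qed
  ultimately show thesis using that[OF _ Z] by blast
qed

text \<open>By compactness the weighted distance attains its maximum \<open>M\<close> at some point;
  the contraction estimate at that point gives \<open>M \<le> \<kappa> * M\<close>, so
  \<open>M\<close> cannot be positive.\<close>

lemma weighted_contraction_unique: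
  fixes w :: "'a::t2_space \<Rightarrow> real" and u u' :: "'a \<Rightarrow> 'b::real_normed_vector"
  assumes S: "compact S" and w: "continuous_on S w" and wpos: "\<And>p. p \<in> S \<Longrightarrow> w p > 0"
    and \<kappa>: "\<kappa> < 1" and u: "continuous_on S u" and u': "continuous_on S u'"
    and contr: "\<And>M p. \<lbrakk>\<And>p. p \<in> S \<Longrightarrow> norm (u p - u' p) \<le> M * w p; p \<in> S\<rbrakk>
      \<Longrightarrow> norm (u p - u' p) \<le> \<kappa> * M * w p"
    and p: "p \<in> S"
  shows "u p = u' p"
proof -
  have "continuous_on S (\<lambda>p. norm (u p - u' p) / w p)"
    by (intro continuous_intros u u' w) (use wpos in force)
  then obtain z where z: "z \<in> S" and max: "\<And>p. p \<in> S \<Longrightarrow> norm (u p - u' p) / w p \<le> norm (u z - u' z) / w z"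
    using continuous_attains_sup[OF S] p by blast
  define M where "M = norm (u z - u' z) / w z"
  have le: "norm (u p - u' p) \<le> M * w p" if "p \<in> S" for p
    using max[OF that] wpos[OF that] by (simp add: M_def pos_divide_le_eq)
  have "M \<le> \<kappa> * M"
    using contr[OF le z] wpos[OF z] by (simp add: M_def field_simps)
  then have "(1 - \<kappa>) * M \<le> 0" by (simp add: algebra_simps)
  then have "M \<le> 0" using \<kappa> by (simp add: mult_le_0_iff)
  then have "norm (u p - u' p) \<le> 0"
    using le[OF p] wpos[OF p] by (meson mult_nonpos_nonneg less_imp_le order_trans)
  then show ?thesis by simp
qed

section \<open>Reflection, linearity and downward transport\<close>

lemma T2_eq_cbox: "T2 = cbox (0, 0) (1, 1)"
  by (simp add: T2_def cbox_Pair_eq)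

text \<open>Replacing \<open>y\<close> by \<open>1 - y\<close> reverses the vertical direction, so
  the equation for \<open>F 1\<close>, whose inflow side is \<open>y = 1\<close>, reduces to the
  upward case already treated.\<close>

lemma characteristic_reflect:
  assumes "characteristic \<tau> v a b X Y"
  shows "characteristic \<tau> (\<lambda>y. - v (1 - y)) a b X (\<lambda>s. 1 - Y s)"
  using assms unfolding characteristic_def T2_def
  by (auto intro!: derivative_eq_intros)

lemma solves_transport_reflect:
  assumes "solves_transport \<tau> (\<lambda>y. - v (1 - y)) r f"
  shows "solves_transport \<tau> v (\<lambda>(x, y). r (x, 1 - y)) (\<lambda>(x, y). f (x, 1 - y))"
  using assms characteristic_reflect[of \<tau> v] unfolding solves_transport_def by fastforce

lemma solves_transport_diff:
  assumes "solves_transport \<tau> v r f" "solves_transport \<tau> v r' f'"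
  shows "solves_transport \<tau> v (\<lambda>p. r p - r' p) (\<lambda>p. f p - f' p)"
  unfolding solves_transport_def
proof (intro allI impI)
  fix a b X Y assume "characteristic \<tau> v a b X Y"
  then have "((\<lambda>s. r (X s, Y s)) has_integral f (X b, Y b) - f (X a, Y a)) {a..b}"
    "((\<lambda>s. r' (X s, Y s)) has_integral f' (X b, Y b) - f' (X a, Y a)) {a..b}"
    using assms unfolding solves_transport_def by blast+
  from has_integral_diff[OF this]
  show "((\<lambda>s. r (X s, Y s) - r' (X s, Y s)) has_integral
      f (X b, Y b) - f' (X b, Y b) - (f (X a, Y a) - f' (X a, Y a))) {a..b}"
    by (simp add: algebra_simps)
qed

lemma solves_transport_cong:
  assumes "solves_transport \<tau> v r f" and "\<And>p. p \<in> T2 \<Longrightarrow> r p = r' p"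
  shows "solves_transport \<tau> v r' f"
  unfolding solves_transport_def
proof (intro allI impI)
  fix a b X Y assume ch: "characteristic \<tau> v a b X Y"
  then have "((\<lambda>s. r (X s, Y s)) has_integral f (X b, Y b) - f (X a, Y a)) {a..b}"
    using assms(1) unfolding solves_transport_def by blast
  then show "((\<lambda>s. r' (X s, Y s)) has_integral f (X b, Y b) - f (X a, Y a)) {a..b}"
    by (rule has_integral_eq[rotated]) (use ch assms(2) in \<open>auto simp: characteristic_def\<close>)
qed

lemma transport_bound_down:
  assumes v: "continuous_on {0..1} v" and pos: "\<And>y. y \<in> {0..1} \<Longrightarrow> v y > 0"
    and \<tau>: "\<tau> > 0" and l: "l > 0"
    and f: "solves_transport \<tau> (\<lambda>y. - v y) r f"
    and r: "\<And>x y. (x, y) \<in> T2 \<Longrightarrow> \<bar>r (x, y)\<bar> \<le> R * exp (l * x)"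
    and in0: "\<And>y. y \<in> {0..1} \<Longrightarrow> f (0, y) = 0"
    and inflow: "\<And>x. x \<in> {0..1} \<Longrightarrow> \<bar>f (x, 1)\<bar> \<le> A * exp (l * x)"
    and xy: "(x, y) \<in> T2"
  shows "\<bar>f (x, y)\<bar> \<le> (A + R * \<tau> / l) * exp (l * x)"
proof -
  have "continuous_on {0..1} (\<lambda>y. v (1 - y))"
    by (rule continuous_on_compose2[OF v]) (auto intro!: continuous_intros)
  moreover have "solves_transport \<tau> (\<lambda>y. v (1 - y)) (\<lambda>(x, y). r (x, 1 - y)) (\<lambda>(x, y). f (x, 1 - y))"
    by (rule solves_transport_reflect) (use f in simp)
  ultimately have "\<bar>case (x, 1 - y) of (x, y) \<Rightarrow> f (x, 1 - y)\<bar> \<le> (A + R * \<tau> / l) * exp (l * x)"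
    using pos \<tau> l r in0 inflow xy
    by (intro transport_bound[where v = "\<lambda>y. v (1 - y)"]) (auto simp: T2_def)
  then show ?thesis by simp
qed

lemma transport_exists_down:
  assumes v: "continuous_on {0..1} v" and pos: "\<And>y. y \<in> {0..1} \<Longrightarrow> v y > 0"
    and \<tau>: "\<tau> > 0" and r: "continuous_on T2 r"
    and b0: "continuous_on {0..1} b0" and h0: "continuous_on {0..1} h0" and corner: "b0 0 = h0 1"
  obtains f where "continuous_on T2 f" "solves_transport \<tau> (\<lambda>y. - v y) r f"
    "\<And>x. x \<in> {0..1} \<Longrightarrow> f (x, 1) = b0 x" "\<And>y. y \<in> {0..1} \<Longrightarrow> f (0, y) = h0 y"
proof -
  have cont: "continuous_on {0..1} (\<lambda>y. g (1 - y))" if "continuous_on {0..1} g" for g :: "real \<Rightarrow> real"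
    by (rule continuous_on_compose2[OF that]) (auto intro!: continuous_intros)
  have contT: "continuous_on T2 (\<lambda>(x, y). g (x, 1 - y))" if "continuous_on T2 g" for g :: "real \<times> real \<Rightarrow> real"
    unfolding split_beta
    by (rule continuous_on_compose2[OF that]) (auto simp: T2_def intro!: continuous_intros)
  obtain f where f: "continuous_on T2 f"
    "solves_transport \<tau> (\<lambda>y. v (1 - y)) (\<lambda>(x, y). r (x, 1 - y)) f"
    "\<And>x. x \<in> {0..1} \<Longrightarrow> f (x, 0) = b0 x" "\<And>y. y \<in> {0..1} \<Longrightarrow> f (0, y) = h0 (1 - y)"
    using transport_exists[OF cont[OF v] _ \<tau> contT[OF r] b0 cont[OF h0]] pos corner by auto
  \<comment> \<open>The right-hand side was reflected before solving; reflecting back restores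
    \<open>r\<close>.\<close>
  have "solves_transport \<tau> (\<lambda>y. - v y) (\<lambda>(x, y). case (x, 1 - y) of (x, y) \<Rightarrow> r (x, 1 - y)) (\<lambda>(x, y). f (x, 1 - y))"
    by (rule solves_transport_reflect) (use f(2) in simp)
  then have "solves_transport \<tau> (\<lambda>y. - v y) r (\<lambda>(x, y). f (x, 1 - y))"
    by (simp add: split_beta)
  then show thesis
    by (rule that[OF contT[OF f(1)]]) (use f(3,4) in auto)
qed

section \<open>The Picard map of the coupled system\<close>

text \<open>\<open>u\<close> is the old iterate, frozen in the coupling terms, and \<open>z\<close>
  the new one. Pairing the two components lets one norm control both, and the relational form fits
  \<open>weighted_contraction_fixpoint\<close>.\<close>

definition picard_step ::
  "real \<Rightarrow> (nat \<Rightarrow> real \<Rightarrow> real) \<Rightarrow> (nat \<Rightarrow> real \<times> real \<Rightarrow> real)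
     \<Rightarrow> (nat \<Rightarrow> nat \<Rightarrow> real \<times> real \<Rightarrow> real) \<Rightarrow> (real \<Rightarrow> real) \<Rightarrow> (nat \<Rightarrow> real \<Rightarrow> real)
     \<Rightarrow> (real \<times> real \<Rightarrow> real \<times> real) \<Rightarrow> (real \<times> real \<Rightarrow> real \<times> real) \<Rightarrow> bool" where
  "picard_step \<tau> \<epsilon> g C q1 h u z \<longleftrightarrow>
     solves_transport \<tau> (\<lambda>y. - \<epsilon> 1 y) (\<lambda>p. g 1 p + (C 1 1 p * fst (u p) + C 1 2 p * snd (u p))) (\<lambda>p. fst (z p)) \<and>
     solves_transport \<tau> (\<epsilon> 2) (\<lambda>p. g 2 p + (C 2 1 p * fst (u p) + C 2 2 p * snd (u p))) (\<lambda>p. snd (z p)) \<and>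
     (\<forall>x\<in>{0..1}. fst (z (x, 1)) = 0) \<and>
     (\<forall>y\<in>{0..1}. fst (z (0, y)) = h 1 y) \<and>
     (\<forall>x\<in>{0..1}. snd (z (x, 0)) = q1 x * fst (z (x, 0))) \<and>
     (\<forall>y\<in>{0..1}. snd (z (0, y)) = h 2 y)"

lemma solves_bvp_iff_picard_step:
  "solves_bvp \<tau> \<epsilon> g C q1 h F \<longleftrightarrow> picard_step \<tau> \<epsilon> g C q1 h (\<lambda>p. (F 1 p, F 2 p)) (\<lambda>p. (F 1 p, F 2 p))"
proof -
  have "(\<Sum>k = 1..2. t k) = t 1 + t 2" for t :: "nat \<Rightarrow> real"
    by (simp add: numeral_2_eq_2)
  then show ?thesis unfolding solves_bvp_def picard_step_def by simp
qed

lemma picard_step_cong: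
  assumes "picard_step \<tau> \<epsilon> g C q1 h u z" and "\<And>p. p \<in> T2 \<Longrightarrow> u p = u' p"
  shows "picard_step \<tau> \<epsilon> g C q1 h u' z"
  using assms unfolding picard_step_def by (auto elim: solves_transport_cong)

text \<open>With \<open>u\<close> frozen the system is triangular: solve for the first component,
  then use its trace on \<open>y = 0\<close> as inflow data for the second. The corner conditions
  are the matching conditions of the two scalar problems.\<close>

lemma picard_step_exists:
  assumes \<tau>: "\<tau> > 0"
    and \<epsilon>: "\<And>i. i \<in> {1, 2} \<Longrightarrow> continuous_on {0..1} (\<epsilon> i)"
    and pos: "\<And>i y. i \<in> {1, 2} \<Longrightarrow> y \<in> {0..1} \<Longrightarrow> \<epsilon> i y > 0"
    and q1: "continuous_on {0..1} q1"
    and h: "\<And>i. i \<in> {1, 2} \<Longrightarrow> continuous_on {0..1} (h i)"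
    and g: "\<And>i. i \<in> {1, 2} \<Longrightarrow> continuous_on T2 (g i)"
    and C: "\<And>i j. i \<in> {1, 2} \<Longrightarrow> j \<in> {1, 2} \<Longrightarrow> continuous_on T2 (C i j)"
    and corner: "h 1 1 = 0" "h 2 0 = q1 0 * h 1 0"
    and u: "continuous_on T2 u"
  shows "\<exists>z. continuous_on T2 z \<and> picard_step \<tau> \<epsilon> g C q1 h u z"
proof -
  have rhs: "continuous_on T2 (\<lambda>p. g i p + (C i 1 p * fst (u p) + C i 2 p * snd (u p)))"
    if "i \<in> {1, 2}" for i
    by (intro continuous_intros g C u that) auto
  obtain f1 where f1: "continuous_on T2 f1"
    "solves_transport \<tau> (\<lambda>y. - \<epsilon> 1 y) (\<lambda>p. g 1 p + (C 1 1 p * fst (u p) + C 1 2 p * snd (u p))) f1"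
    "\<And>x. x \<in> {0..1} \<Longrightarrow> f1 (x, 1) = 0" "\<And>y. y \<in> {0..1} \<Longrightarrow> f1 (0, y) = h 1 y"
    using transport_exists_down[OF \<epsilon>[of 1] pos[of 1] \<tau> rhs[of 1] continuous_on_const h[of 1]] corner(1)
    by auto
  have "continuous_on {0..1} (\<lambda>x. q1 x * f1 (x, 0))"
    by (intro continuous_on_mult q1 continuous_on_compose2[OF f1(1)] continuous_intros)
      (auto simp: T2_def)
  moreover have "q1 0 * f1 (0, 0) = h 2 0" using f1(4)[of 0] corner(2) by simp
  ultimately obtain f2 where "continuous_on T2 f2"
    "solves_transport \<tau> (\<epsilon> 2) (\<lambda>p. g 2 p + (C 2 1 p * fst (u p) + C 2 2 p * snd (u p))) f2"
    "\<And>x. x \<in> {0..1} \<Longrightarrow> f2 (x, 0) = q1 x * f1 (x, 0)" "\<And>y. y \<in> {0..1} \<Longrightarrow> f2 (0, y) = h 2 y"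
    using transport_exists[OF \<epsilon>[of 2] pos[of 2] \<tau> rhs[of 2] _ h[of 2]] by auto
  with f1 show ?thesis
    by (intro exI[of _ "\<lambda>p. (f1 p, f2 p)"]) (auto simp: picard_step_def intro: continuous_on_Pair)
qed

text \<open>In the difference of two steps \<open>g\<close> and \<open>h\<close> cancel, leaving
  homogeneous data on \<open>x = 0\<close> and coupling terms that are linear in
  \<open>u - u'\<close>. The scalar bound contributes \<open>R * \<tau> / l\<close> for the first
  component and \<open>(Q + 1)\<close> times this for the second, where \<open>Q\<close> accounts
  for the reflected inflow.\<close>

lemma picard_step_contraction:
  assumes \<tau>: "\<tau> > 0"
    and \<epsilon>: "\<And>i. i \<in> {1, 2} \<Longrightarrow> continuous_on {0..1} (\<epsilon> i)"
    and pos: "\<And>i y. i \<in> {1, 2} \<Longrightarrow> y \<in> {0..1} \<Longrightarrow> \<epsilon> i y > 0"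
    and K: "K \<ge> 0" "\<And>i j p. i \<in> {1, 2} \<Longrightarrow> j \<in> {1, 2} \<Longrightarrow> p \<in> T2 \<Longrightarrow> \<bar>C i j p\<bar> \<le> K"
    and Q: "Q \<ge> 0" "\<And>x. x \<in> {0..1} \<Longrightarrow> \<bar>q1 x\<bar> \<le> Q"
    and l: "l = 4 * K * \<tau> * (Q + 2) + 1"
    and step: "picard_step \<tau> \<epsilon> g C q1 h u z" "picard_step \<tau> \<epsilon> g C q1 h u' z'"
    and le: "\<And>p. p \<in> T2 \<Longrightarrow> norm (u p - u' p) \<le> M * exp (l * fst p)"
    and p: "p \<in> T2"
  shows "norm (z p - z' p) \<le> 1 / 2 * M * exp (l * fst p)"
proof -
  \<comment> \<open>Two coupling terms, each at most \<open>K * M\<close> times the weight. The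
    summand 1 in \<open>l\<close> keeps \<open>l\<close> positive even if
    \<open>K = 0\<close>.\<close>
  define R where "R = 2 * K * M"
  have l0: "l > 0" unfolding l using K(1) Q(1) \<tau> by (simp add: add_nonneg_pos)
  have M: "M \<ge> 0"
    using order_trans[OF norm_ge_zero le[OF p]] by (simp add: zero_le_mult_iff)
  have rhs: "\<bar>(g i p + (C i 1 p * fst (u p) + C i 2 p * snd (u p)))
      - (g i p + (C i 1 p * fst (u' p) + C i 2 p * snd (u' p)))\<bar> \<le> R * exp (l * fst p)"
    if i: "i \<in> {1, 2}" and p: "p \<in> T2" for i p
  proof -
    have 1: "\<bar>fst (u p - u' p)\<bar> \<le> M * exp (l * fst p)" "\<bar>snd (u p - u' p)\<bar> \<le> M * exp (l * fst p)"
      using norm_fst_le[of "fst (u p - u' p)" "snd (u p - u' p)"]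
        norm_snd_le[of "snd (u p - u' p)" "fst (u p - u' p)"] le[OF p]
      unfolding prod.collapse real_norm_def by linarith+
    have "(g i p + (C i 1 p * fst (u p) + C i 2 p * snd (u p)))
      - (g i p + (C i 1 p * fst (u' p) + C i 2 p * snd (u' p)))
      = C i 1 p * fst (u p - u' p) + C i 2 p * snd (u p - u' p)"
      by (simp add: algebra_simps)
    also have "\<bar>\<dots>\<bar> \<le> \<bar>C i 1 p\<bar> * \<bar>fst (u p - u' p)\<bar> + \<bar>C i 2 p\<bar> * \<bar>snd (u p - u' p)\<bar>"
      by (metis abs_mult abs_triangle_ineq)
    also have "\<dots> \<le> K * (M * exp (l * fst p)) + K * (M * exp (l * fst p))"
      by (intro add_mono mult_mono 1 K(2)[OF i _ p]) (use K in auto)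
    finally show ?thesis by (simp add: R_def)
  qed
  have b1: "\<bar>fst (z (x, y)) - fst (z' (x, y))\<bar> \<le> R * \<tau> / l * exp (l * x)" if "(x, y) \<in> T2" for x y
  proof -
    have "solves_transport \<tau> (\<lambda>y. - \<epsilon> 1 y)
       (\<lambda>p. (g 1 p + (C 1 1 p * fst (u p) + C 1 2 p * snd (u p)))
         - (g 1 p + (C 1 1 p * fst (u' p) + C 1 2 p * snd (u' p)))) (\<lambda>p. fst (z p) - fst (z' p))"
      using step unfolding picard_step_def by (intro solves_transport_diff) auto
    \<comment> \<open>The inflow constant is 0 because both first components vanish on
      \<open>y = 1\<close>.\<close>
    from transport_bound_down[OF \<epsilon> pos \<tau> l0 this _ _ _ that, of R 0] rhs[of 1] step show ?thesis
      by (auto simp: picard_step_def)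
  qed
  have b2: "\<bar>snd (z (x, y)) - snd (z' (x, y))\<bar> \<le> (Q * (R * \<tau> / l) + R * \<tau> / l) * exp (l * x)"
    if xy: "(x, y) \<in> T2" for x y
  proof -
    have "solves_transport \<tau> (\<epsilon> 2)
       (\<lambda>p. (g 2 p + (C 2 1 p * fst (u p) + C 2 2 p * snd (u p)))
         - (g 2 p + (C 2 1 p * fst (u' p) + C 2 2 p * snd (u' p)))) (\<lambda>p. snd (z p) - snd (z' p))"
      using step unfolding picard_step_def by (intro solves_transport_diff) auto
    moreover have "\<bar>snd (z (x, 0)) - snd (z' (x, 0))\<bar> \<le> Q * (R * \<tau> / l) * exp (l * x)"
      if x: "x \<in> {0..1}" for x
    proof -
      have "\<bar>snd (z (x, 0)) - snd (z' (x, 0))\<bar> = \<bar>q1 x\<bar> * \<bar>fst (z (x, 0)) - fst (z' (x, 0))\<bar>"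
        using step x by (simp add: picard_step_def flip: abs_mult right_diff_distrib)
      also have "\<dots> \<le> Q * (R * \<tau> / l * exp (l * x))"
        using x by (intro mult_mono Q b1) (auto simp: T2_def)
      finally show ?thesis by simp
    qed
    ultimately show ?thesis
      using transport_bound[OF \<epsilon>[of 2] pos[of 2] \<tau> l0 _ _ _ _ xy, of _ "\<lambda>p. snd (z p) - snd (z' p)"] rhs[of 2] step
      by (auto simp: picard_step_def)
  qed
  have "norm (z p - z' p) \<le> \<bar>fst (z p) - fst (z' p)\<bar> + \<bar>snd (z p) - snd (z' p)\<bar>"
    using norm_Pair_le[of "fst (z p - z' p)" "snd (z p - z' p)"]
    unfolding prod.collapse real_norm_def by simp
  also have "\<dots> \<le> R * \<tau> / l * exp (l * fst p) + (Q * (R * \<tau> / l) + R * \<tau> / l) * exp (l * fst p)"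
    using b1[of "fst p" "snd p"] b2[of "fst p" "snd p"] p by simp
  also have "\<dots> = (2 * K * \<tau> * (Q + 2) / l) * (M * exp (l * fst p))"
    by (simp add: R_def algebra_simps add_divide_distrib)
  also have "\<dots> \<le> 1 / 2 * (M * exp (l * fst p))"
  proof (rule mult_right_mono)
    \<comment> \<open>The factor 4 in \<open>l\<close> makes \<open>l / 2\<close> exceed this
      numerator by \<open>1 / 2\<close>.\<close>
    show "2 * K * \<tau> * (Q + 2) / l \<le> 1 / 2"
      unfolding pos_divide_le_eq[OF l0] by (simp add: l)
  qed (use M in simp)
  finally show ?thesis by simp
qed

section \<open>Existence and uniqueness for the boundary value problem\<close>

theorem theorem1:
  fixes \<tau> :: real
    and \<epsilon> :: "nat \<Rightarrow> real \<Rightarrow> real"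
    and q1 :: "real \<Rightarrow> real"
    and h :: "nat \<Rightarrow> real \<Rightarrow> real"
    and g :: "nat \<Rightarrow> real \<times> real \<Rightarrow> real"
    and C :: "nat \<Rightarrow> nat \<Rightarrow> real \<times> real \<Rightarrow> real"
  assumes "\<tau> > 0"
    and "\<And>i. i \<in> {1, 2} \<Longrightarrow> continuous_on {0..1} (\<epsilon> i)"
    and "\<And>i y. i \<in> {1, 2} \<Longrightarrow> y \<in> {0..1} \<Longrightarrow> \<epsilon> i y > 0"
    and "continuous_on {0..1} q1"
    and "\<And>i. i \<in> {1, 2} \<Longrightarrow> continuous_on {0..1} (h i)"
    and "\<And>i. i \<in> {1, 2} \<Longrightarrow> continuous_on T2 (g i)"
    and "\<And>i j. i \<in> {1, 2} \<Longrightarrow> j \<in> {1, 2} \<Longrightarrow> continuous_on T2 (C i j)"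
    and corner_F1: "h 1 1 = 0"
    and corner_F2: "h 2 0 = q1 0 * h 1 0"
  shows "\<exists>F. (\<forall>k\<in>{1, 2}. continuous_on T2 (F k)) \<and> solves_bvp \<tau> \<epsilon> g C q1 h F \<and>
           (\<forall>G. (\<forall>k\<in>{1, 2}. continuous_on T2 (G k)) \<and> solves_bvp \<tau> \<epsilon> g C q1 h G \<longrightarrow>
              (\<forall>k\<in>{1, 2}. \<forall>p\<in>T2. G k p = F k p))"
proof -
  have T2: "compact T2" unfolding T2_eq_cbox by (rule compact_cbox)
  have "bounded (\<Union>i\<in>{1, 2}. \<Union>j\<in>{1, 2}. C i j ` T2)"
    by (intro bounded_UN ballI compact_imp_bounded compact_continuous_image assms(7) T2) auto
  then obtain K where K: "K > 0" "\<And>i j p. i \<in> {1, 2} \<Longrightarrow> j \<in> {1, 2} \<Longrightarrow> p \<in> T2 \<Longrightarrow> \<bar>C i j p\<bar> \<le> K"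
    unfolding bounded_pos by fastforce
  have "bounded (q1 ` {0..1})"
    by (intro compact_imp_bounded compact_continuous_image assms(4)) simp
  then obtain Q where Q: "Q > 0" "\<And>x. x \<in> {0..1} \<Longrightarrow> \<bar>q1 x\<bar> \<le> Q"
    unfolding bounded_pos by auto
  define l where "l = 4 * K * \<tau> * (Q + 2) + 1"
  define w where "w p = exp (l * fst p)" for p :: "real \<times> real"
  have w: "continuous_on T2 w" "\<And>p. p \<in> T2 \<Longrightarrow> w p > 0"
    unfolding w_def by (auto intro!: continuous_intros)
  have contr: "norm (z p - z' p) \<le> 1 / 2 * M * w p"
    if "picard_step \<tau> \<epsilon> g C q1 h u z" "picard_step \<tau> \<epsilon> g C q1 h u' z'"
      "\<And>p. p \<in> T2 \<Longrightarrow> norm (u p - u' p) \<le> M * w p" "p \<in> T2" for u u' z z' M p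
    using picard_step_contraction[where K = K and Q = Q and l = l, OF assms(1-3) _ _ _ _ l_def that(1,2)]
      that(3,4) K Q unfolding w_def by simp
  obtain u z where u: "continuous_on T2 u" "picard_step \<tau> \<epsilon> g C q1 h u z" "\<And>p. p \<in> T2 \<Longrightarrow> z p = u p"
  proof (rule weighted_contraction_fixpoint[of "(0, 0)" "(1, 1)" w "1 / 2" "picard_step \<tau> \<epsilon> g C q1 h",
        folded T2_eq_cbox])
    show "\<exists>z. continuous_on T2 z \<and> picard_step \<tau> \<epsilon> g C q1 h u z" if "continuous_on T2 u" for u
      by (rule picard_step_exists[OF assms that])
  qed (use w contr in \<open>auto simp: Basis_prod_def\<close>)
  \<comment> \<open>\<open>u\<close> and \<open>z\<close> agree only on \<open>T2\<close>, but
    \<open>picard_step\<close> reads its input only there, so \<open>z\<close> is a Picard image of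
    itself.\<close>
  have cz: "continuous_on T2 z" using u(1,3) by (simp cong: continuous_on_cong)
  have zz: "picard_step \<tau> \<epsilon> g C q1 h z z" using picard_step_cong[OF u(2)] u(3) by simp
  \<comment> \<open>Indices other than 1 and 2 receive the second component as an arbitrary
    default.\<close>
  define F where "F k p = (if k = 1 then fst (z p) else snd (z p))" for k :: nat and p
  have F: "(\<lambda>p. (F 1 p, F 2 p)) = z" by (simp add: F_def)
  show ?thesis
  proof (intro exI[of _ F] conjI allI impI)
    show "\<forall>k\<in>{1, 2}. continuous_on T2 (F k)"
      unfolding F_def using cz by (auto intro!: continuous_intros)
    show "solves_bvp \<tau> \<epsilon> g C q1 h F"
      unfolding solves_bvp_iff_picard_step F by (rule zz)
    fix G assume G: "(\<forall>k\<in>{1, 2}. continuous_on T2 (G k)) \<and> solves_bvp \<tau> \<epsilon> g C q1 h G"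
    then have step: "picard_step \<tau> \<epsilon> g C q1 h (\<lambda>p. (G 1 p, G 2 p)) (\<lambda>p. (G 1 p, G 2 p))"
      unfolding solves_bvp_iff_picard_step by blast
    have cG: "continuous_on T2 (\<lambda>p. (G 1 p, G 2 p))"
      using G by (intro continuous_on_Pair) auto
    \<comment> \<open>Each solution is its own Picard image, so the contraction estimate bounds the
      difference of the two solutions by half of itself.\<close>
    have "(G 1 p, G 2 p) = z p" if "p \<in> T2" for p
      by (rule weighted_contraction_unique[where \<kappa> = "1 / 2", OF T2 w _ cG cz _ that])
        (assumption, simp, rule contr[OF step zz])
    then have "G 1 p = fst (z p)" "G 2 p = snd (z p)" if "p \<in> T2" for p
      using that by (metis fst_conv, metis snd_conv)
    then show "\<forall>k\<in>{1, 2}. \<forall>p\<in>T2. G k p = F k p"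
      by (simp add: F_def)
  qed
qed

end
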